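(* Let $n,c\ge 2$ and $1\le s\le c-1$ be integers, let $t=\lceil sn/c\rceil$ and let $\lambda\in[c]$ satisfy $\lambda\equiv sn\pmod c$. If $q\ge\frac{t}{n-t+1}\left(\binom{n}{t}-m(n,t,\lambda;s+1,c-s+1)\right)$, then \[f^q_{c,s}(n)\le\frac{\binom{n}{t}}{\binom{n}{t}-m(n,t,\lambda;s+1,c-s+1)}\,q^t.\]
   Context: $[m]=\{1,\dots,m\}$. A code $\mathcal{C}\subseteq[q]^n$ is $(c,s)$-frameproof if for every $c+1$ codewords $\bm x^0,\dots,\bm x^c\in\mathcal{C}$ with $\bm x^0\neq\bm x^j$ for each $j\in[c]$ ($\bm x^1,\dots,\bm x^c$ not necessarily distinct), there is a coordinate $i\in[n]$ with $|\{j\in[c]:x^j_i=x^0_i\}|<s$. $f^q_{c,s}(n)$ is the maximum size of a $(c,s)$-frameproof code in $[q]^n$. A sequence $A_1,\dots,A_\lambda$ of subsets of $[n]$ (repetitions allowed) is $(k_1,k_2)$-disjoint if $\bigcap_{i\in B}A_i=\emptyset$ for every $k_1$-subset $B\subseteq[\lambda]$ and $\bigcup_{i\in B}A_i=[n]$ for every $k_2$-subset $B\subseteq[\lambda]$ (each condition vacuous if the subset size exceeds $\lambda$). $m(n,t,\lambda;k_1,k_2)$ is the maximum size of a family of $t$-subsets of $[n]$ containing no $A_1,\dots,A_\lambda$ (not necessarily distinct members) forming a $(k_1,k_2)$-disjoint sequence. *)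

theory Defs
  imports Complex_Main "HOL-Library.FuncSet" "HOL-Number_Theory.Cong"
begin

definition frameproof :: "nat \<Rightarrow> nat \<Rightarrow> nat \<Rightarrow> nat \<Rightarrow> (nat \<Rightarrow> nat) set \<Rightarrow> bool" where
  "frameproof q n c s C \<longleftrightarrow>
     C \<subseteq> ({1..n} \<rightarrow>\<^sub>E {1..q}) \<and>
     (\<forall>x0\<in>C. \<forall>x :: nat \<Rightarrow> nat \<Rightarrow> nat.
        (\<forall>j\<in>{1..c}. x j \<in> C \<and> x0 \<noteq> x j) \<longrightarrow>
        (\<exists>i\<in>{1..n}. card {j\<in>{1..c}. x j i = x0 i} < s))"

text \<open>Both maxima below range over finite sets; these are nonempty since the empty code is always
  admissible, and so is the empty family when the sequence length is positive.\<close>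

definition max_frameproof :: "nat \<Rightarrow> nat \<Rightarrow> nat \<Rightarrow> nat \<Rightarrow> nat" where
  "max_frameproof q c s n = Max (card ` {C. frameproof q n c s C})"

definition disjoint_seq :: "nat \<Rightarrow> nat \<Rightarrow> nat \<Rightarrow> nat \<Rightarrow> (nat \<Rightarrow> nat set) \<Rightarrow> bool" where
  "disjoint_seq n l k1 k2 A \<longleftrightarrow>
     (\<forall>i\<in>{1..l}. A i \<subseteq> {1..n}) \<and>
     (\<forall>B\<subseteq>{1..l}. card B = k1 \<longrightarrow> (\<Inter>i\<in>B. A i) = {}) \<and>
     (\<forall>B\<subseteq>{1..l}. card B = k2 \<longrightarrow> (\<Union>i\<in>B. A i) = {1..n})"

definition disjoint_seq_free :: "nat \<Rightarrow> nat \<Rightarrow> nat \<Rightarrow> nat \<Rightarrow> nat \<Rightarrow> nat set set \<Rightarrow> bool" where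
  "disjoint_seq_free n t l k1 k2 F \<longleftrightarrow>
     F \<subseteq> {A. A \<subseteq> {1..n} \<and> card A = t} \<and>
     \<not> (\<exists>A :: nat \<Rightarrow> nat set. (\<forall>i\<in>{1..l}. A i \<in> F) \<and> disjoint_seq n l k1 k2 A)"

definition max_disjoint_seq_free :: "nat \<Rightarrow> nat \<Rightarrow> nat \<Rightarrow> nat \<Rightarrow> nat \<Rightarrow> nat" where
  "max_disjoint_seq_free n t l k1 k2 = Max (card ` {F. disjoint_seq_free n t l k1 k2 F})"

end

theory Submission
  imports Defs
begin

text \<open>Say that a codeword \<open>x\<close> owns a set \<open>T\<close> of coordinates if no other codeword agrees with it on
  \<open>T\<close>. Write \<open>s * n = l * t + (c - l) * (t - 1)\<close>. A disjoint sequence of \<open>l\<close> sets of size \<open>t\<close> can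
  always be completed by \<open>c - l\<close> sets of size \<open>t - 1\<close> so that every coordinate is covered exactly
  \<open>s\<close> times. Hence if \<open>x\<close> owns no set of size \<open>t - 1\<close>, then the \<open>t\<close>-sets that it does not own
  contain no disjoint sequence, and \<open>x\<close> owns at least \<open>M = binomial n t - m\<close> sets of size \<open>t\<close>. If
  \<open>x\<close> owns some \<open>B\<close> of size \<open>t - 1\<close>, then in each of the \<open>n - t + 1\<close> sets \<open>T = insert b B\<close> it
  excludes everyone else from \<open>q\<close> of the \<open>q ^ t\<close> words on \<open>T\<close>. Counting, for all pairs \<open>b \<in> T\<close>, the
  words on \<open>T\<close> used up by owners of \<open>T\<close> and of \<open>T - {b}\<close> gives
  \<open>t * M * |C0| + q * (n - t + 1) * |C1| \<le> t * binomial n t * q ^ t\<close>, where \<open>C1\<close> consists of the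
  codewords owning a \<open>(t - 1)\<close>-set, and \<open>C0\<close> of the others.\<close>

subsection \<open>Set sequences with prescribed degrees\<close>

lemma obtain_set_between:
  assumes "finite H" "L \<subseteq> H" "card L \<le> r" "r \<le> card H"
  obtains B where "L \<subseteq> B" "B \<subseteq> H" "card B = r"
proof -
  have fL: "finite L" using assms finite_subset by blast
  have "r - card L \<le> card (H - L)"
    using assms fL by (simp add: card_Diff_subset)
  then obtain D where D: "D \<subseteq> H - L" "card D = r - card L" "finite D"
    by (rule obtain_subset_with_card_n)
  have "card (L \<union> D) = r"
    using D fL assms(3) by (subst card_Un_disjoint) auto
  then show thesis using that[of "L \<union> D"] D assms(2) by blast
qed

text \<open>The induction removes one set containing all points of maximal degree \<open>k\<close> and none of
  degree \<open>0\<close>.\<close>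

lemma sets_with_degrees:
  fixes d :: "'a \<Rightarrow> nat"
  assumes "finite X" "\<And>i. i \<in> X \<Longrightarrow> d i \<le> k" "(\<Sum>i\<in>X. d i) = k * r"
  shows "\<exists>A :: nat \<Rightarrow> 'a set. (\<forall>j\<in>{1..k}. A j \<subseteq> X \<and> card (A j) = r) \<and>
           (\<forall>i\<in>X. card {j\<in>{1..k}. i \<in> A j} = d i)"
  using assms
proof (induction k arbitrary: d)
  case 0
  then show ?case by simp
next
  case (Suc k)
  define L where "L = {i\<in>X. d i = Suc k}"
  define H where "H = {i\<in>X. 0 < d i}"
  have fin: "finite L" "finite H" using Suc.prems(1) by (auto simp: L_def H_def)
  \<comment> \<open>A total degree of \<open>Suc k * r\<close> leaves room for at most
    \<open>r\<close> points of degree \<open>Suc k\<close>, and requires at least \<open>r\<close>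
    points of positive degree. So a set of size \<open>r\<close> fits between \<open>L\<close> and
    \<open>H\<close>.\<close>
  have "Suc k * card L = (\<Sum>i\<in>L. d i)"
    by (simp add: L_def)
  also have "\<dots> \<le> (\<Sum>i\<in>X. d i)"
    using Suc.prems(1) by (intro sum_mono2) (auto simp: L_def)
  finally have "Suc k * card L \<le> Suc k * r"
    using Suc.prems(3) by simp
  then have Lr: "card L \<le> r" by (simp only: Suc_mult_le_cancel1)
  have "Suc k * r = (\<Sum>i\<in>H. d i)"
    unfolding Suc.prems(3)[symmetric] using Suc.prems(1)
    by (intro sum.mono_neutral_right) (auto simp: H_def)
  also have "\<dots> \<le> (\<Sum>i\<in>H. Suc k)"
    using Suc.prems(2) by (intro sum_mono) (auto simp: H_def)
  also have "\<dots> = Suc k * card H" by simp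
  finally have rH: "r \<le> card H" by (simp only: Suc_mult_le_cancel1)
  have LH: "L \<subseteq> H" by (auto simp: L_def H_def)
  obtain B where B: "L \<subseteq> B" "B \<subseteq> H" "card B = r"
    using obtain_set_between[OF fin(2) LH Lr rH] .
  have BX: "B \<subseteq> X" using B(2) by (auto simp: H_def)
  define d' where "d' = (\<lambda>i. d i - of_bool (i \<in> B))"
  \<comment> \<open>Truncated subtraction is harmless: \<open>B\<close> lies in \<open>H\<close>, so
    only positive degrees are lowered.\<close>
  have d': "d i = d' i + of_bool (i \<in> B)" if "i \<in> X" for i
    using B(2) by (auto simp: d'_def H_def)
  have "d' i \<le> k" if "i \<in> X" for i
  proof (cases "i \<in> B")
    case True
    then show ?thesis using Suc.prems(2)[OF that] by (simp add: d'_def)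
  next
    case False
    then have "d i \<noteq> Suc k" using that B(1) by (auto simp: L_def)
    then show ?thesis using Suc.prems(2)[OF that] by (simp add: d'_def)
  qed
  moreover have "(\<Sum>i\<in>X. d' i) = k * r"
  proof -
    have "(\<Sum>i\<in>X. d i) = (\<Sum>i\<in>X. d' i) + (\<Sum>i\<in>X. of_bool (i \<in> B))"
      unfolding sum.distrib[symmetric] by (rule sum.cong) (auto simp: d')
    also have "(\<Sum>i\<in>X. of_bool (i \<in> B)) = r"
      using Suc.prems(1) BX B(3) by (simp add: Int_absorb1)
    finally show ?thesis using Suc.prems(3) by simp
  qed
  ultimately obtain A :: "nat \<Rightarrow> 'a set"
    where A: "\<forall>j\<in>{1..k}. A j \<subseteq> X \<and> card (A j) = r"
      "\<forall>i\<in>X. card {j\<in>{1..k}. i \<in> A j} = d' i"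
    using Suc.IH[of d'] Suc.prems(1) by blast
  define A' where "A' = A(Suc k := B)"
  have "card {j\<in>{1..Suc k}. i \<in> A' j} = d i" if "i \<in> X" for i
  proof -
    have "{j\<in>{1..Suc k}. i \<in> A' j}
        = {j\<in>{1..k}. i \<in> A j} \<union> (if i \<in> B then {Suc k} else {})"
      by (auto simp: A'_def le_Suc_eq)
    also have "card \<dots> = d i"
      using A(2) that d'[OF that] by (subst card_Un_disjoint) auto
    finally show ?thesis .
  qed
  moreover have "\<forall>j\<in>{1..Suc k}. A' j \<subseteq> X \<and> card (A' j) = r"
    using A(1) B(3) BX by (auto simp: A'_def le_Suc_eq)
  ultimately show ?case by blast
qed

text \<open>The most even distribution works: \<open>S div n\<close> everywhere, and one more on the
  first \<open>S mod n\<close> points.\<close>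

lemma balanced_function_with_sum:
  fixes n S lo hi :: nat
  assumes "0 < n" "n * lo \<le> S" "S \<le> n * hi"
  obtains d :: "nat \<Rightarrow> nat" where "(\<Sum>i\<in>{1..n}. d i) = S" "\<And>i. lo \<le> d i" "\<And>i. d i \<le> hi"
proof
  define d where "d = (\<lambda>i::nat. S div n + of_bool (i \<in> {1..S mod n}))"
  have "{1..n} \<inter> {1..S mod n} = {1..S mod n}"
    using assms(1) mod_less_divisor[of n S] by auto
  then have "(\<Sum>i\<in>{1..n}. of_bool (i \<in> {1..S mod n})) = S mod n"
    by (subst sum_of_bool_eq) (simp_all only: finite_atLeastAtMost Collect_mem_eq card_atLeastAtMost, simp_all)
  then show "(\<Sum>i\<in>{1..n}. d i) = S"
    unfolding d_def sum.distrib by simp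
  have "lo \<le> S div n"
    using assms by (simp add: less_eq_div_iff_mult_less_eq mult.commute)
  then show "lo \<le> d i" for i by (simp add: d_def)
  show "d i \<le> hi" for i
  proof (cases "i \<in> {1..S mod n}")
    case True
    \<comment> \<open>A point receiving the extra unit exists only if the remainder is positive.
      Then \<open>S div n\<close> is strictly below \<open>hi\<close>.\<close>
    then have "n * (S div n) < S"
      using mult_div_mod_eq[of n S] by (simp only: atLeastAtMost_iff) linarith
    then have "n * (S div n) < n * hi" using assms(3) by linarith
    then show ?thesis by (simp add: d_def)
  next
    case False
    have "n * (S div n) \<le> n * hi"
      using assms(3) times_div_less_eq_dividend[of n S] by linarith
    then have "S div n \<le> hi" using assms(1) by simp
    then show ?thesis unfolding d_def using False by (simp only: of_bool_eq add_0_right)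
  qed
qed

subsection \<open>Disjoint sequences\<close>

text \<open>Both conditions are pointwise: a point spoils some intersection of \<open>s + 1\<close>
  sets exactly when its degree exceeds \<open>s\<close>, and some union of \<open>c - s + 1\<close>
  sets exactly when more than \<open>c - s\<close> sets miss it. The second bound is written
  additively because \<open>l + s - c\<close> may truncate.\<close>

lemma disjoint_seq_iff_degrees:
  assumes "s \<le> c"
  shows "disjoint_seq n l (s + 1) (c - s + 1) A \<longleftrightarrow>
    (\<forall>j\<in>{1..l}. A j \<subseteq> {1..n}) \<and>
    (\<forall>i\<in>{1..n}. card {j\<in>{1..l}. i \<in> A j} \<le> s \<and> l + s \<le> card {j\<in>{1..l}. i \<in> A j} + c)"
    (is "?L \<longleftrightarrow> ?sub \<and> (\<forall>i\<in>_. ?deg i)")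
proof -
  have co: "card {j\<in>{1..l}. i \<in> A j} + card {j\<in>{1..l}. i \<notin> A j} = l" for i
  proof -
    have "{1..l} = {j\<in>{1..l}. i \<in> A j} \<union> {j\<in>{1..l}. i \<notin> A j}" by auto
    then have "card {1..l} = card {j\<in>{1..l}. i \<in> A j} + card {j\<in>{1..l}. i \<notin> A j}"
      by (metis (no_types, lifting) card_Un_disjoint disjoint_iff finite_Un
          finite_atLeastAtMost mem_Collect_eq)
    then show ?thesis by simp
  qed
  show ?thesis
  proof
    assume L: ?L
    have "?deg i" if i: "i \<in> {1..n}" for i
    proof
      show "card {j\<in>{1..l}. i \<in> A j} \<le> s"
      proof (rule ccontr)
        assume "\<not> ?thesis"
        then have "s + 1 \<le> card {j\<in>{1..l}. i \<in> A j}" by simp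
        then obtain B where B: "B \<subseteq> {j\<in>{1..l}. i \<in> A j}" "card B = s + 1"
          using obtain_subset_with_card_n by metis
        then have "i \<in> (\<Inter>j\<in>B. A j)" "B \<subseteq> {1..l}" by auto
        then show False using L B(2) unfolding disjoint_seq_def by blast
      qed
      have "card {j\<in>{1..l}. i \<notin> A j} \<le> c - s"
      proof (rule ccontr)
        assume "\<not> ?thesis"
        then have "c - s + 1 \<le> card {j\<in>{1..l}. i \<notin> A j}" by simp
        then obtain B where B: "B \<subseteq> {j\<in>{1..l}. i \<notin> A j}" "card B = c - s + 1"
          using obtain_subset_with_card_n by metis
        then have "i \<notin> (\<Union>j\<in>B. A j)" "B \<subseteq> {1..l}" by auto
        then show False using L B(2) i unfolding disjoint_seq_def by blast
      qed
      then show "l + s \<le> card {j\<in>{1..l}. i \<in> A j} + c"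
        using co[of i] assms by linarith
    qed
    then show "?sub \<and> (\<forall>i\<in>{1..n}. ?deg i)"
      using L by (auto simp: disjoint_seq_def)
  next
    assume R: "?sub \<and> (\<forall>i\<in>{1..n}. ?deg i)"
    have "(\<Inter>j\<in>B. A j) = {}" if B: "B \<subseteq> {1..l}" "card B = s + 1" for B
    proof (rule ccontr)
      assume "\<not> ?thesis"
      then obtain i where i: "i \<in> (\<Inter>j\<in>B. A j)" by blast
      have "B \<noteq> {}" using B(2) by auto
      then have "i \<in> {1..n}" using i R B(1) by blast
      moreover have "card B \<le> card {j\<in>{1..l}. i \<in> A j}"
        using i B(1) by (intro card_mono) auto
      ultimately show False using R B(2) by fastforce
    qed
    moreover have "(\<Union>j\<in>B. A j) = {1..n}" if B: "B \<subseteq> {1..l}" "card B = c - s + 1" for B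
    proof (rule ccontr)
      assume "\<not> ?thesis"
      then obtain i where i: "i \<in> {1..n}" "i \<notin> (\<Union>j\<in>B. A j)" using R B(1) by blast
      have "card B \<le> card {j\<in>{1..l}. i \<notin> A j}"
        using i B(1) by (intro card_mono) auto
      moreover have "l + s \<le> card {j\<in>{1..l}. i \<in> A j} + c" using R i(1) by blast
      ultimately show False using co[of i] B(2) assms by linarith
    qed
    ultimately show ?L using R unfolding disjoint_seq_def by blast
  qed
qed

text \<open>Needed to make the denominator of the final bound positive. Spreading the
  \<open>l * t\<close> incidences evenly over the points keeps every degree in the range that
  characterises disjoint sequences.\<close>

lemma disjoint_seq_exists:
  assumes sn: "s * n + c = c * t + l" and "0 < n" "s \<le> c" "l \<le> c" "1 \<le> t" "t \<le> n"
  shows "\<exists>A. (\<forall>j\<in>{1..l}. A j \<subseteq> {1..n} \<and> card (A j) = t) \<and> disjoint_seq n l (s + 1) (c - s + 1) A"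
proof -
  obtain a where c: "c = l + a" using assms(4) le_Suc_ex by blast
  obtain b where n: "n = t + b" using assms(6) le_Suc_ex by blast
  obtain u where u: "t = 1 + u" using assms(5) le_Suc_ex by blast
  have sn': "s * n = (l + a) * u + l" using sn unfolding c u by (simp add: algebra_simps)
  \<comment> \<open>With \<open>c = l + a\<close> and \<open>t = 1 + u\<close>, the difference
    \<open>s * n - l * t\<close> equals \<open>a * u\<close>. As \<open>u \<le> n\<close>, it is at
    most \<open>a * n\<close>, which rearranges to the claim.\<close>
  have "n * (l + s - c) \<le> l * t"
  proof -
    have "a * u \<le> a * n" using n u by (intro mult_le_mono2) simp
    then have "n * l + ((l + a) * u + l) \<le> l * (1 + u) + n * (l + a)"
      by (simp add: algebra_simps)
    then have "n * (l + s) \<le> l * t + n * c"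
      unfolding sn'[symmetric] c u by (simp add: algebra_simps)
    then show ?thesis by (simp add: diff_mult_distrib2)
  qed
  moreover have "l * t \<le> n * min s l"
  proof -
    have "l * t \<le> s * n" unfolding sn' u by (simp add: algebra_simps)
    moreover have "l * t \<le> l * n" using assms(6) by simp
    ultimately show ?thesis by (simp add: min_def mult.commute)
  qed
  ultimately obtain d where d: "(\<Sum>i\<in>{1..n}. d i) = l * t"
      "\<And>i. l + s - c \<le> d i" "\<And>i. d i \<le> min s l"
    using balanced_function_with_sum assms(2) by metis
  have "\<And>i. d i \<le> l" using d(3) by simp
  then obtain A where A: "\<forall>j\<in>{1..l}. A j \<subseteq> {1..n} \<and> card (A j) = t"
      "\<forall>i\<in>{1..n}. card {j\<in>{1..l}. i \<in> A j} = d i"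
    using sets_with_degrees[OF finite_atLeastAtMost _ d(1)] by blast
  have "card {j\<in>{1..l}. i \<in> A j} \<le> s \<and> l + s \<le> card {j\<in>{1..l}. i \<in> A j} + c"
    if "i \<in> {1..n}" for i
    using A(2) that d(2)[of i] d(3)[of i] by auto
  then have "disjoint_seq n l (s + 1) (c - s + 1) A"
    using A(1) unfolding disjoint_seq_iff_degrees[OF assms(3)] by blast
  then show ?thesis using A(1) by blast
qed

text \<open>The deficits \<open>s - d i\<close> sum to \<open>(c - l) * (t - 1)\<close>, and the
  lower degree bound says exactly that none exceeds \<open>c - l\<close>. Hence they are the degrees
  of \<open>c - l\<close> sets of size \<open>t - 1\<close>.\<close>

lemma disjoint_seq_completion:
  assumes sn: "s * n + c = c * t + l" and "s \<le> c" "l \<le> c" "1 \<le> t"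
    and A: "\<And>j. j \<in> {1..l} \<Longrightarrow> card (A j) = t" "disjoint_seq n l (s + 1) (c - s + 1) A"
  obtains B where "\<And>j. j \<in> {1..c - l} \<Longrightarrow> B j \<subseteq> {1..n} \<and> card (B j) = t - 1"
    "\<And>i. i \<in> {1..n} \<Longrightarrow> card {j\<in>{1..l}. i \<in> A j} + card {j\<in>{1..c - l}. i \<in> B j} = s"
proof -
  define d where "d = (\<lambda>i. card {j\<in>{1..l}. i \<in> A j})"
  note deg = A(2)[unfolded disjoint_seq_iff_degrees[OF assms(2)]]
  have d: "d i \<le> s \<and> l + s \<le> d i + c" if "i \<in> {1..n}" for i
    using deg that by (auto simp: d_def)
  have "(\<Sum>i\<in>{1..n}. d i) = (\<Sum>j\<in>{1..l}. card {i\<in>{1..n}. i \<in> A j})"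
    unfolding d_def by (rule sum_multicount_gen[symmetric]) auto
  also have "\<dots> = (\<Sum>j\<in>{1..l}. t)"
  proof (rule sum.cong)
    fix j assume "j \<in> {1..l}"
    then have "{i\<in>{1..n}. i \<in> A j} = A j" using deg by blast
    then show "card {i\<in>{1..n}. i \<in> A j} = t" using A(1) \<open>j \<in> {1..l}\<close> by simp
  qed simp
  finally have sumd: "(\<Sum>i\<in>{1..n}. d i) = l * t" by simp
  have "(\<Sum>i\<in>{1..n}. s - d i) + (\<Sum>i\<in>{1..n}. d i) = (\<Sum>i\<in>{1..n}. s)"
    unfolding sum.distrib[symmetric] by (rule sum.cong) (use d in auto)
  then have "(\<Sum>i\<in>{1..n}. s - d i) + l * t = s * n"
    unfolding sumd by (simp add: mult.commute)
  moreover obtain a where "c = l + a" using assms(3) le_Suc_ex by blast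
  moreover obtain u where "t = 1 + u" using assms(4) le_Suc_ex by blast
  ultimately have "(\<Sum>i\<in>{1..n}. s - d i) = (c - l) * (t - 1)"
    using sn by (simp add: algebra_simps)
  moreover have "s - d i \<le> c - l" if "i \<in> {1..n}" for i
    using d[OF that] by linarith
  ultimately obtain B where B: "\<forall>j\<in>{1..c - l}. B j \<subseteq> {1..n} \<and> card (B j) = t - 1"
      "\<forall>i\<in>{1..n}. card {j\<in>{1..c - l}. i \<in> B j} = s - d i"
    using sets_with_degrees[of "{1..n}" "\<lambda>i. s - d i" "c - l" "t - 1"] finite_atLeastAtMost by blast
  show thesis
  proof (rule that)
    show "B j \<subseteq> {1..n} \<and> card (B j) = t - 1" if "j \<in> {1..c - l}" for j
      using B(1) that by blast
    show "card {j\<in>{1..l}. i \<in> A j} + card {j\<in>{1..c - l}. i \<in> B j} = s" if "i \<in> {1..n}" for i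
      using B(2) that d[OF that] by (simp add: d_def)
  qed
qed

lemma disjoint_seq_free_finite: "finite {F. disjoint_seq_free n t l k1 k2 F}"
  by (rule finite_subset[of _ "Pow (Pow {1..n})"]) (auto simp: disjoint_seq_free_def)

lemma disjoint_seq_free_card_le:
  "disjoint_seq_free n t l k1 k2 F \<Longrightarrow> card F \<le> max_disjoint_seq_free n t l k1 k2"
  unfolding max_disjoint_seq_free_def using disjoint_seq_free_finite by (intro Max_ge) auto

text \<open>The family of all \<open>t\<close>-sets contains the given sequence, so an extremal free
  family is a proper subfamily. By \<open>1 \<le> l\<close> the empty family is free, hence the
  maximum is attained.\<close>

lemma max_disjoint_seq_free_less:
  assumes "1 \<le> l" and A: "\<And>j. j \<in> {1..l} \<Longrightarrow> A j \<subseteq> {1..n} \<and> card (A j) = t" "disjoint_seq n l k1 k2 A"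
  shows "max_disjoint_seq_free n t l k1 k2 < n choose t"
proof -
  let ?T = "{S. S \<subseteq> {1..n} \<and> card S = t}"
  have "disjoint_seq_free n t l k1 k2 {}"
    using assms(1) by (auto simp: disjoint_seq_free_def)
  then have "max_disjoint_seq_free n t l k1 k2 \<in> card ` {F. disjoint_seq_free n t l k1 k2 F}"
    unfolding max_disjoint_seq_free_def using disjoint_seq_free_finite by (intro Max_in) auto
  then obtain F where F: "disjoint_seq_free n t l k1 k2 F"
      "max_disjoint_seq_free n t l k1 k2 = card F"
    by auto
  have "F \<subseteq> ?T" using F(1) by (simp add: disjoint_seq_free_def)
  moreover have "F \<noteq> ?T"
    using F(1) A unfolding disjoint_seq_free_def by blast
  ultimately have "card F < card ?T" by (intro psubset_card_mono) auto
  then show ?thesis using F(2) by (simp add: n_subsets)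
qed

subsection \<open>Owned coordinate sets\<close>

definition owns :: "('i \<Rightarrow> 'a) set \<Rightarrow> ('i \<Rightarrow> 'a) \<Rightarrow> 'i set \<Rightarrow> bool" where
  "owns C x T \<longleftrightarrow> (\<forall>y\<in>C. (\<forall>i\<in>T. y i = x i) \<longrightarrow> y = x)"

lemma ownsD: "owns C x T \<Longrightarrow> y \<in> C \<Longrightarrow> (\<And>i. i \<in> T \<Longrightarrow> y i = x i) \<Longrightarrow> y = x"
  by (auto simp: owns_def)

text \<open>A disjoint sequence of unowned \<open>t\<close>-sets would complete to \<open>c\<close>
  unowned sets covering each coordinate exactly \<open>s\<close> times. Choosing for each set
  another codeword agreeing with \<open>x\<close> on it would give at least \<open>s\<close>
  agreements at every coordinate, against frameproofness.\<close>

lemma not_owned_disjoint_seq_free: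
  assumes fp: "frameproof q n c s C" and x: "x \<in> C"
    and no: "\<And>B. B \<subseteq> {1..n} \<Longrightarrow> card B = t - 1 \<Longrightarrow> \<not> owns C x B"
    and sn: "s * n + c = c * t + l" and "s \<le> c" "l \<le> c" "1 \<le> t"
  shows "disjoint_seq_free n t l (s + 1) (c - s + 1)
           {T. T \<subseteq> {1..n} \<and> card T = t \<and> \<not> owns C x T}" (is "disjoint_seq_free _ _ _ _ _ ?F")
proof -
  have False if AF: "\<And>j. j \<in> {1..l} \<Longrightarrow> A j \<in> ?F" and A: "disjoint_seq n l (s + 1) (c - s + 1) A" for A
  proof -
    have "card (A j) = t" if "j \<in> {1..l}" for j using AF[OF that] by simp
    from disjoint_seq_completion[OF sn assms(5-7) this A]
    obtain B where B: "\<And>j. j \<in> {1..c - l} \<Longrightarrow> B j \<subseteq> {1..n} \<and> card (B j) = t - 1"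
      "\<And>i. i \<in> {1..n} \<Longrightarrow> card {j\<in>{1..l}. i \<in> A j} + card {j\<in>{1..c - l}. i \<in> B j} = s"
      by blast
    \<comment> \<open>Concatenation: indices up to \<open>l\<close> carry \<open>A\<close>, the
      other \<open>c - l\<close> carry \<open>B\<close> shifted by \<open>l\<close>.\<close>
    define D where "D = (\<lambda>j. if j \<le> l then A j else B (j - l))"
    have "\<not> owns C x (D j)" if "j \<in> {1..c}" for j
    proof (cases "j \<le> l")
      case True
      then show ?thesis using AF[of j] that by (simp add: D_def)
    next
      case False
      then have "j - l \<in> {1..c - l}" using that by auto
      then show ?thesis using no B(1) False by (simp add: D_def)
    qed
    then have ex: "\<exists>z. z \<in> C \<and> z \<noteq> x \<and> (\<forall>i\<in>D j. z i = x i)" if "j \<in> {1..c}" for j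
      using that by (auto simp: owns_def)
    define y where "y = (\<lambda>j. SOME z. z \<in> C \<and> z \<noteq> x \<and> (\<forall>i\<in>D j. z i = x i))"
    have y: "y j \<in> C \<and> y j \<noteq> x \<and> (\<forall>i\<in>D j. y j i = x i)" if "j \<in> {1..c}" for j
      unfolding y_def using someI_ex[OF ex[OF that]] .
    then have "\<forall>j\<in>{1..c}. y j \<in> C \<and> x \<noteq> y j" by blast
    with fp x have "\<exists>i\<in>{1..n}. card {j\<in>{1..c}. y j i = x i} < s"
      unfolding frameproof_def by simp
    then obtain i where i: "i \<in> {1..n}" "card {j\<in>{1..c}. y j i = x i} < s" by blast
    have "s = card {j\<in>{1..l}. i \<in> A j} + card ((\<lambda>j. j + l) ` {j\<in>{1..c - l}. i \<in> B j})"
      using B(2)[OF i(1)] by (subst card_image) auto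
    also have "\<dots> = card ({j\<in>{1..l}. i \<in> A j} \<union> (\<lambda>j. j + l) ` {j\<in>{1..c - l}. i \<in> B j})"
      by (rule card_Un_disjoint[symmetric]) auto
    also have "\<dots> \<le> card {j\<in>{1..c}. i \<in> D j}"
      using assms(6) by (intro card_mono) (auto simp: D_def)
    also have "\<dots> \<le> card {j\<in>{1..c}. y j i = x i}"
      using y by (intro card_mono) auto
    finally show False using i(2) by simp
  qed
  then have "\<not> (\<exists>A. (\<forall>j\<in>{1..l}. A j \<in> ?F) \<and> disjoint_seq n l (s + 1) (c - s + 1) A)"
    by (intro notI) (elim exE conjE, metis)
  moreover have "?F \<subseteq> {A. A \<subseteq> {1..n} \<and> card A = t}" by blast
  ultimately show ?thesis unfolding disjoint_seq_free_def by (intro conjI)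
qed

text \<open>The words on \<open>T\<close> that are restrictions of members of \<open>C0\<close> owning \<open>T\<close>, and the words on \<open>T\<close>
  obtained from owners of \<open>T - {b}\<close> by changing coordinate \<open>b\<close> at will, are all distinct.\<close>

lemma owners_count:
  fixes C C0 :: "('i \<Rightarrow> 'a) set"
  assumes "finite C" "finite Q" and CQ: "\<And>x i. x \<in> C \<Longrightarrow> i \<in> T \<Longrightarrow> x i \<in> Q"
    and "finite T" and b: "b \<in> T"
    and C0: "C0 \<subseteq> C" "\<And>x. x \<in> C0 \<Longrightarrow> \<not> owns C x (T - {b})"
  shows "card {x\<in>C0. owns C x T} + card Q * card {x\<in>C. owns C x (T - {b})} \<le> card Q ^ card T"
proof -
  define E1 where "E1 = {x\<in>C0. owns C x T}"
  define E2 where "E2 = {x\<in>C. owns C x (T - {b})}"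
  define f where "f = (\<lambda>x::'i \<Rightarrow> 'a. restrict x T)"
  define g where "g = (\<lambda>(x::'i \<Rightarrow> 'a, v). restrict (x(b := v)) T)"
  have fin: "finite E1" "finite E2"
    using assms(1) C0(1) by (auto simp: E1_def E2_def intro: finite_subset)
  have f_agree: "x i = y i" if "f x = f y" "i \<in> T" for x y i
    using fun_cong[OF that(1), of i] that(2) by (simp add: f_def)
  have g_agree: "x i = y i" if "g (x, v) = g (y, w)" "i \<in> T - {b}" for x y v w i
    using fun_cong[OF that(1), of i] that(2) by (simp add: g_def)
  have "inj_on f E1"
  proof (rule inj_onI)
    fix x y assume "x \<in> E1" "y \<in> E1" "f x = f y"
    then show "x = y"
      using C0(1) f_agree[of x y] by (intro ownsD[of C y T x]) (auto simp: E1_def)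
  qed
  moreover have "inj_on g (E2 \<times> Q)"
  proof (rule inj_onI, clarify)
    fix x y v w assume *: "x \<in> E2" "y \<in> E2" "g (x, v) = g (y, w)"
    have "v = w" using fun_cong[OF *(3), of b] b by (simp add: g_def)
    moreover have "x = y"
      using * g_agree[OF *(3)] by (intro ownsD[of C y "T - {b}" x]) (auto simp: E2_def)
    ultimately show "x = y \<and> v = w" by simp
  qed
  moreover have "f ` E1 \<inter> g ` (E2 \<times> Q) = {}"
  proof (rule ccontr)
    assume "\<not> ?thesis"
    then obtain x y v where *: "x \<in> E1" "y \<in> E2" "f x = g (y, v)" by auto
    \<comment> \<open>A common word agrees with \<open>y\<close> away from \<open>b\<close>, so
      \<open>y\<close> owning \<open>T - {b}\<close> forces \<open>x = y\<close>. But a member of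
      \<open>C0\<close> does not own \<open>T - {b}\<close>.\<close>
    have "x i = y i" if "i \<in> T - {b}" for i
      using fun_cong[OF *(3), of i] that by (simp add: f_def g_def)
    then have "x = y"
      using * C0(1) by (intro ownsD[of C y "T - {b}" x]) (auto simp: E1_def E2_def)
    then show False using * C0(2) by (auto simp: E1_def E2_def)
  qed
  ultimately have "card (f ` E1 \<union> g ` (E2 \<times> Q)) = card E1 + card Q * card E2"
    using fin assms(2)
    by (subst card_Un_disjoint) (auto simp: card_image card_cartesian_product)
  moreover have "f ` E1 \<union> g ` (E2 \<times> Q) \<subseteq> T \<rightarrow>\<^sub>E Q"
    using CQ C0(1) by (auto simp: f_def g_def E1_def E2_def PiE_iff)
  moreover have "finite (T \<rightarrow>\<^sub>E Q)" using assms(2,4) by (simp add: finite_PiE)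
  moreover have "card (T \<rightarrow>\<^sub>E Q) = card Q ^ card T" using assms(4) by (simp add: card_funcsetE)
  ultimately show ?thesis
    using card_mono by (metis E1_def E2_def)
qed

section \<open>The weighted double count of codewords\<close>

lemma frameproof_finite: "frameproof q n c s C \<Longrightarrow> finite C"
  by (rule finite_subset[of _ "{1..n} \<rightarrow>\<^sub>E {1..q}"]) (auto simp: frameproof_def intro: finite_PiE)

text \<open>The sets \<open>insert b B\<close> with \<open>b\<close> outside \<open>B\<close> are
  distinct \<open>t\<close>-sets, and each contributes at least the point \<open>b\<close>, since
  removing it leaves the owned set \<open>B\<close>.\<close>

lemma owned_extensions_count:
  assumes X: "finite X" "B \<subseteq> X" "card B = t - 1" "1 \<le> t"
    and own: "owns C x B"
  shows "card X + 1 - t \<le> (\<Sum>T | T \<subseteq> X \<and> card T = t. card {b\<in>T. owns C x (T - {b})})"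
proof -
  have fB: "finite B" using X(1,2) finite_subset by blast
  let ?e = "\<lambda>b. insert b B"
  have ins: "card (?e b) = t" if "b \<in> X - B" for b
    using that fB X(3,4) by simp
  have "card X + 1 - t = card (X - B)"
    using X fB by (simp add: card_Diff_subset)
  also have "\<dots> = card (?e ` (X - B))"
    by (rule card_image[symmetric]) (auto simp: inj_on_def)
  also have "\<dots> = (\<Sum>T\<in>?e ` (X - B). 1)" by simp
  also have "\<dots> \<le> (\<Sum>T\<in>?e ` (X - B). card {b\<in>T. owns C x (T - {b})})"
  proof (rule sum_mono)
    fix T assume "T \<in> ?e ` (X - B)"
    then obtain b where b: "b \<in> X - B" "T = insert b B" by blast
    then have "T - {b} = B" by blast
    then have "b \<in> {b\<in>T. owns C x (T - {b})}" using b own by simp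
    moreover have "finite {b\<in>T. owns C x (T - {b})}" using b fB by simp
    ultimately show "1 \<le> card {b\<in>T. owns C x (T - {b})}"
      by (metis One_nat_def Suc_leI card_gt_0_iff empty_iff)
  qed
  also have "\<dots> \<le> (\<Sum>T | T \<subseteq> X \<and> card T = t. card {b\<in>T. owns C x (T - {b})})"
    using X(1,2) ins by (intro sum_mono2) auto
  finally show ?thesis .
qed

text \<open>The target bound with denominators cleared; \<open>m + M = n choose t\<close> avoids
  truncated subtraction.\<close>

lemma frameproof_card_bound:
  fixes q n c s t l m M :: nat
  assumes fp: "frameproof q n c s C"
    and sn: "s * n + c = c * t + l" and "s \<le> c" "l \<le> c" "1 \<le> t"
    and m: "m = max_disjoint_seq_free n t l (s + 1) (c - s + 1)" "m + M = n choose t"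
    and q: "t * M \<le> q * (n + 1 - t)"
  shows "M * card C \<le> (n choose t) * q ^ t"
proof -
  define TT where "TT = {T. T \<subseteq> {1..n} \<and> card T = t}"
  define C1 where "C1 = {x\<in>C. \<exists>B\<subseteq>{1..n}. card B = t - 1 \<and> owns C x B}"
  define C0 where "C0 = C - C1"
  have finC: "finite C" using fp by (rule frameproof_finite)
  have fin: "finite C0" "finite C1" "finite TT"
    using finC by (auto simp: C0_def C1_def TT_def)
  have cTT: "card TT = n choose t" by (simp add: TT_def n_subsets)
  have cC: "card C = card C0 + card C1"
    using finC unfolding C0_def
    by (subst card_Un_disjoint[symmetric]) (auto simp: C1_def intro: arg_cong[where f = card])
  have few: "M \<le> card {T\<in>TT. owns C x T}" if "x \<in> C0" for x
  proof -
    have x: "x \<in> C" "\<And>B. B \<subseteq> {1..n} \<Longrightarrow> card B = t - 1 \<Longrightarrow> \<not> owns C x B"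
      using that by (auto simp: C0_def C1_def)
    let ?F = "{T. T \<subseteq> {1..n} \<and> card T = t \<and> \<not> owns C x T}"
    have "card ?F \<le> m"
      unfolding m(1)
      using not_owned_disjoint_seq_free[OF fp x sn assms(3-5)] by (rule disjoint_seq_free_card_le)
    moreover have "card TT = card {T\<in>TT. owns C x T} + card ?F"
      using fin(3)
      by (subst card_Un_disjoint[symmetric]) (auto simp: TT_def intro: arg_cong[where f = card])
    ultimately show ?thesis using cTT m(2) by linarith
  qed
  \<comment> \<open>The bound of \<open>owners_count\<close> is summed over the \<open>t\<close>
    choices of \<open>b\<close>. The owners of \<open>T\<close> do not depend on \<open>b\<close>,
    hence the factor \<open>t\<close>.\<close>
  have local_bound:
    "t * card {x\<in>C0. owns C x T} + q * (\<Sum>b\<in>T. card {x\<in>C. owns C x (T - {b})}) \<le> t * q ^ t"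
    if T: "T \<in> TT" for T
  proof -
    have Tn: "T \<subseteq> {1..n}" "card T = t" "finite T"
      using T finite_subset by (auto simp: TT_def)
    have "card {x\<in>C0. owns C x T} + q * card {x\<in>C. owns C x (T - {b})} \<le> q ^ t"
      if b: "b \<in> T" for b
    proof -
      have "\<not> owns C x (T - {b})" if "x \<in> C0" for x
      proof -
        have "T - {b} \<subseteq> {1..n}" "card (T - {b}) = t - 1" using Tn b by auto
        then show ?thesis using that unfolding C0_def C1_def by blast
      qed
      moreover have "x i \<in> {1..q}" if "x \<in> C" "i \<in> T" for x i
      proof -
        have "x \<in> {1..n} \<rightarrow>\<^sub>E {1..q}" using fp that(1) by (auto simp: frameproof_def)
        then show ?thesis using that(2) Tn(1) PiE_mem by blast
      qed
      ultimately show ?thesis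
        using owners_count[of C "{1..q}" T b C0] finC Tn b by (auto simp: C0_def)
    qed
    then have "(\<Sum>b\<in>T. card {x\<in>C0. owns C x T} + q * card {x\<in>C. owns C x (T - {b})})
        \<le> (\<Sum>b\<in>T. q ^ t)"
      by (rule sum_mono)
    then show ?thesis by (simp add: sum.distrib sum_distrib_left Tn(2))
  qed
  have "M * card C0 \<le> (\<Sum>x\<in>C0. card {T\<in>TT. owns C x T})"
    using sum_mono[of C0 "\<lambda>_. M", OF few] by (simp add: mult.commute)
  also have "\<dots> = (\<Sum>T\<in>TT. card {x\<in>C0. owns C x T})"
    using fin by (intro sum_multicount_gen) auto
  finally have part0: "M * card C0 \<le> (\<Sum>T\<in>TT. card {x\<in>C0. owns C x T})" .
  have "card C1 * (n + 1 - t) \<le> (\<Sum>x\<in>C1. \<Sum>T\<in>TT. card {b\<in>T. owns C x (T - {b})})"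
  proof -
    have "n + 1 - t \<le> (\<Sum>T\<in>TT. card {b\<in>T. owns C x (T - {b})})" if "x \<in> C1" for x
      using that owned_extensions_count[OF finite_atLeastAtMost _ _ assms(5), of _ 1 n C x]
      by (auto simp: C1_def TT_def)
    then show ?thesis using sum_mono[of C1 "\<lambda>_. n + 1 - t"] by simp
  qed
  also have "\<dots> = (\<Sum>T\<in>TT. \<Sum>x\<in>C1. card {b\<in>T. owns C x (T - {b})})"
    by (rule sum.swap)
  also have "\<dots> = (\<Sum>T\<in>TT. \<Sum>b\<in>T. card {x\<in>C1. owns C x (T - {b})})"
    using fin(2) by (intro sum.cong sum_multicount_gen) (auto simp: TT_def intro: finite_subset)
  also have "\<dots> \<le> (\<Sum>T\<in>TT. \<Sum>b\<in>T. card {x\<in>C. owns C x (T - {b})})"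
    using finC by (intro sum_mono card_mono) (auto simp: C1_def)
  finally have part1: "card C1 * (n + 1 - t)
      \<le> (\<Sum>T\<in>TT. \<Sum>b\<in>T. card {x\<in>C. owns C x (T - {b})})" .
  have "t * (M * card C) = t * (M * card C0) + (t * M) * card C1"
    by (simp add: cC algebra_simps)
  \<comment> \<open>The lower bound on \<open>q\<close> enters here: it lets each member of
    \<open>C1\<close> be charged \<open>q * (n + 1 - t)\<close> instead of
    \<open>t * M\<close>.\<close>
  also have "\<dots> \<le> t * (M * card C0) + q * (card C1 * (n + 1 - t))"
    using mult_le_mono1[OF q, of "card C1"] by (simp add: mult_ac)
  also have "\<dots> \<le> t * (\<Sum>T\<in>TT. card {x\<in>C0. owns C x T})
      + q * (\<Sum>T\<in>TT. \<Sum>b\<in>T. card {x\<in>C. owns C x (T - {b})})"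
    using part0 part1 by (intro add_mono mult_le_mono2)
  also have "\<dots> = (\<Sum>T\<in>TT. t * card {x\<in>C0. owns C x T}
      + q * (\<Sum>b\<in>T. card {x\<in>C. owns C x (T - {b})}))"
    by (simp add: sum.distrib sum_distrib_left)
  also have "\<dots> \<le> (\<Sum>T\<in>TT. t * q ^ t)"
    using local_bound by (rule sum_mono)
  also have "\<dots> = t * ((n choose t) * q ^ t)" by (simp add: cTT)
  finally show ?thesis using assms(5) by simp
qed

section \<open>From the ceiling and the congruence to integer identities\<close>

lemma ceiling_div_decomposition:
  fixes a c l :: nat
  assumes "0 < a" "l \<in> {1..c}" "[l = a] (mod c)"
  shows "a + c = c * nat \<lceil>real a / real c\<rceil> + l" "1 \<le> nat \<lceil>real a / real c\<rceil>"
proof -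
  \<comment> \<open>Otherwise \<open>c\<close> would divide \<open>l - a\<close>, which lies
    strictly between \<open>0\<close> and \<open>c\<close> because \<open>a\<close> is
    positive.\<close>
  have "l \<le> a"
  proof (rule ccontr)
    assume "\<not> l \<le> a"
    then have "c dvd l - a" using assms(3) by (simp add: cong_altdef_nat)
    then have "c \<le> l - a" using \<open>\<not> l \<le> a\<close> by (intro dvd_imp_le) auto
    then show False using assms \<open>\<not> l \<le> a\<close> by auto
  qed
  then obtain k where k: "a = k * c + l"
    using assms(3) cong_le_nat cong_sym by blast
  \<comment> \<open>Since \<open>l\<close> ranges over \<open>1\<close> to \<open>c\<close>, not
    \<open>0\<close> to \<open>c - 1\<close>, the quotient lies above \<open>k\<close> and at most
    at \<open>k + 1\<close>.\<close>
  have "\<lceil>real a / real c\<rceil> = int k + 1"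
    using assms(2) by (intro ceiling_unique) (auto simp: k field_simps)
  then have "nat \<lceil>real a / real c\<rceil> = k + 1" by linarith
  then show "a + c = c * nat \<lceil>real a / real c\<rceil> + l" "1 \<le> nat \<lceil>real a / real c\<rceil>"
    by (simp_all add: k)
qed

theorem theorem3p1:
  fixes n c s t l q :: nat
  assumes "n \<ge> 2" and "c \<ge> 2" and "1 \<le> s" and "s \<le> c - 1"
    and "t = nat \<lceil>real (s * n) / real c\<rceil>"
    and "l \<in> {1..c}" and "[l = s * n] (mod c)"
    and "real q \<ge> real t / (real n - real t + 1) *
           (real (n choose t) - real (max_disjoint_seq_free n t l (s + 1) (c - s + 1)))"
  shows "real (max_frameproof q c s n) \<le>
           real (n choose t) /
             (real (n choose t) - real (max_disjoint_seq_free n t l (s + 1) (c - s + 1)))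
           * real q ^ t"
proof -
  define m where "m = max_disjoint_seq_free n t l (s + 1) (c - s + 1)"
  define M where "M = (n choose t) - m"
  have sc: "s \<le> c" and lc: "l \<le> c" and n0: "0 < n" using assms by auto
  have sn: "s * n + c = c * t + l" and t1: "1 \<le> t"
    using ceiling_div_decomposition[of "s * n" l c] assms by auto
  have tn: "t \<le> n"
  proof (rule ccontr)
    assume "\<not> t \<le> n"
    then have "c * (n + 1) \<le> c * t" by (intro mult_le_mono2) simp
    moreover have "s * n \<le> c * n" using sc by simp
    ultimately have "s * n + c \<le> c * t" unfolding distrib_left by linarith
    then show False using sn assms(6) by simp
  qed
  have mlt: "m < n choose t"
  proof -
    obtain A where "\<forall>j\<in>{1..l}. A j \<subseteq> {1..n} \<and> card (A j) = t"
        "disjoint_seq n l (s + 1) (c - s + 1) A"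
      using disjoint_seq_exists[OF sn n0 sc lc t1 tn] by blast
    then show ?thesis
      unfolding m_def using assms(6) by (intro max_disjoint_seq_free_less[of l A]) auto
  qed
  then have mM: "m + M = n choose t" by (simp add: M_def)
  have M: "real (n choose t) - real m = real M" using mM by linarith
  have "real (t * M) \<le> real (q * (n + 1 - t))"
  proof -
    \<comment> \<open>Only \<open>t \<le> n\<close> lets the real denominator be read as a positive
      natural number and cleared.\<close>
    have "real n - real t + 1 = real (n + 1 - t)" using tn by simp
    moreover have "0 < n + 1 - t" using tn by simp
    ultimately show ?thesis
      using assms(8) unfolding m_def[symmetric] M by (simp add: field_simps)
  qed
  then have q: "t * M \<le> q * (n + 1 - t)" by linarith
  have "finite {C. frameproof q n c s C}"
    by (rule finite_subset[of _ "Pow ({1..n} \<rightarrow>\<^sub>E {1..q})"])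
       (auto simp: frameproof_def intro: finite_PiE)
  moreover have "frameproof q n c s {}" by (simp add: frameproof_def)
  ultimately have "max_frameproof q c s n \<in> card ` {C. frameproof q n c s C}"
    unfolding max_frameproof_def by (intro Max_in) auto
  then obtain C where C: "frameproof q n c s C" "max_frameproof q c s n = card C" by auto
  have "real (M * card C) \<le> real ((n choose t) * q ^ t)"
    using frameproof_card_bound[OF C(1) sn sc lc t1 m_def mM q] by (simp only: of_nat_le_iff)
  then show ?thesis
    using mlt unfolding m_def[symmetric] M C(2) by (simp add: M_def field_simps)
qed

end
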